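(* Let $n>3$ be an integer. Then: (1) There is a one-to-one correspondence between the basis $B(\overline{FK}_{C_n}(n))$ of $\overline{FK}_{C_n}(n)$ and the set of matchings in the $n$-cycle graph $C_n$. (2) The dimension of $\overline{FK}_{C_n}(n)$ equals the number of matchings in the $n$-cycle graph $C_n$.
   Context: Let $F$ be a field and $n>3$. $\overline{FK}_{C_n}(n)$ is the quotient of the Fomin-Kirillov algebra $FK(n)$ by the ideal generated by the $x_{ij}$ for which $\{i,j\}$ is not an edge of the $n$-cycle $C_n$ (vertices $1,\dots,n$, edges $\overline{12},\overline{23},\dots,\overline{n-1,n},\overline{1n}$). Explicitly, it is the associative unital $F$-algebra on generators $x_{1n}=-x_{n1}$ and $x_{m,m+1}=-x_{m+1,m}$ ($1\le m\le n-1$), that is, the free associative algebra on the $n$ letters $x_{12},x_{23},\dots,x_{n-1,n},x_{1n}$ modulo the two-sided ideal $I$ generated by the relations - $x_{m,m+1}^2=0$ for $1\le m\le n-1$, and $x_{1n}^2=0$; - $x_{m,m+1}x_{m+1,m+2}=0$ and $x_{m+1,m+2}x_{m,m+1}=0$ for $1\le m\le n-2$; - $x_{n-1,n}x_{1n}=0$, $x_{1n}x_{n-1,n}=0$, $x_{12}x_{1n}=0$, $x_{1n}x_{12}=0$; - $x_{m,m+1}x_{l,l+1}-x_{l,l+1}x_{m,m+1}=0$ for $1\le m\le l-2$, $3\le l\le n-1$; - $x_{m,m+1}x_{1n}-x_{1n}x_{m,m+1}=0$ for $2\le m\le n-2$. Monomial order: variables are ordered by $x_{ij}>x_{kl}$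 if $j<l$, or $j=l$ and $i>k$ (so $x_{12}>x_{23}>\dots>x_{n-1,n}>x_{1n}$). Words are ordered by graded lexicographic order: first by degree, and words of equal degree are compared lexicographically from the left using the variable order. The basis $B(\overline{FK}_{C_n}(n))$ is the set of (classes of) all words in the letters $x_{12},\dots,x_{n-1,n},x_{1n}$ that are not divisible by (do not contain as a contiguous subword) the leading word of any element of the Gröbner basis of $I$ with respect to this order. A matching in a graph is a subset of the set of edges in which no two edges have a common vertex (the empty set is a matching). *)

theory Defs
  imports
    "HOL-Library.Poly_Mapping"
    "HOL-Library.Sublist"
    "HOL-Library.Disjoint_Sets"
    "HOL-Algebra.QuotRing"
    "HOL-Algebra.Embedded_Algebras"
begin

section \<open>Free associative algebras\<close>

text \<open>With concatenation of words as the monoid operation on lists, the convolution product of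
  finitely supported functions on words is the product of noncommutative polynomials.\<close>

instantiation list :: (type) monoid_add
begin

definition zero_list :: "'a list" where "zero_list = []"

definition plus_list :: "'a list \<Rightarrow> 'a list \<Rightarrow> 'a list" where "plus_list = append"

instance by standard (simp_all add: zero_list_def plus_list_def)

end

definition free_algebra :: "'x set \<Rightarrow> ('x list \<Rightarrow>\<^sub>0 'f::field) ring" where
  "free_algebra X =
    \<lparr>carrier = {p. Poly_Mapping.keys p \<subseteq> lists X}, mult = (*), one = 1, zero = 0, add = (+)\<rparr>"

abbreviation mon :: "'x list \<Rightarrow> ('x list \<Rightarrow>\<^sub>0 'f::field)" where
  "mon w \<equiv> Poly_Mapping.single w 1"

lemma ring_free_algebra: "ring (free_algebra X :: ('x list \<Rightarrow>\<^sub>0 'f::field) ring)"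
proof -
  let ?C = "{p :: 'x list \<Rightarrow>\<^sub>0 'f. Poly_Mapping.keys p \<subseteq> lists X}"
  have mult: "p * q \<in> ?C" if "p \<in> ?C" "q \<in> ?C" for p q
    using that keys_mult[of p q] by (fastforce simp: plus_list_def)
  have add: "p + q \<in> ?C" if "p \<in> ?C" "q \<in> ?C" for p q
    using that Poly_Mapping.keys_add[of p q] by blast
  have uminus: "- p \<in> ?C" if "p \<in> ?C" for p
    using that by simp
  have one: "1 \<in> ?C"
    by (auto simp: zero_list_def simp flip: single_one)
  have ag: "abelian_group (free_algebra X :: ('x list \<Rightarrow>\<^sub>0 'f) ring)"
  proof (rule abelian_groupI)
    fix p :: "'x list \<Rightarrow>\<^sub>0 'f" assume "p \<in> carrier (free_algebra X)"
    then show "\<exists>q\<in>carrier (free_algebra X). q \<oplus>\<^bsub>free_algebra X\<^esub> p = \<zero>\<^bsub>free_algebra X\<^esub>"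
      using uminus[of p] by (intro bexI[of _ "- p"]) (simp_all add: free_algebra_def)
  qed (use add in \<open>simp_all add: free_algebra_def add_ac\<close>)
  have mo: "Group.monoid (free_algebra X :: ('x list \<Rightarrow>\<^sub>0 'f) ring)"
    by (rule Group.monoidI) (use mult one in \<open>simp_all add: free_algebra_def mult.assoc\<close>)
  show ?thesis
    by (rule ringI[OF ag mo]) (simp_all add: free_algebra_def algebra_simps)
qed


section \<open>The algebra of the \<open>n\<close>-cycle\<close>

text \<open>The letter \<open>(i, j)\<close> with \<open>i < j\<close> is the generator \<open>x\<^sub>i\<^sub>j\<close>; the generator
  \<open>x\<^sub>j\<^sub>i\<close> is not a further letter since it equals \<open>- x\<^sub>i\<^sub>j\<close>.\<close>

type_synonym var = "nat \<times> nat"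

definition cycle_vars :: "nat \<Rightarrow> var set" where
  "cycle_vars n = {(m, m + 1) | m. 1 \<le> m \<and> m \<le> n - 1} \<union> {(1, n)}"

definition gen :: "nat \<Rightarrow> nat \<Rightarrow> (var list \<Rightarrow>\<^sub>0 'f::field)" where
  "gen i j = mon [(i, j)]"

definition fk_relations :: "nat \<Rightarrow> (var list \<Rightarrow>\<^sub>0 'f::field) set" where
  "fk_relations n =
     {gen m (m+1) * gen m (m+1) | m. 1 \<le> m \<and> m \<le> n - 1} \<union> {gen 1 n * gen 1 n}
   \<union> {gen m (m+1) * gen (m+1) (m+2) | m. 1 \<le> m \<and> m \<le> n - 2}
   \<union> {gen (m+1) (m+2) * gen m (m+1) | m. 1 \<le> m \<and> m \<le> n - 2}
   \<union> {gen (n-1) n * gen 1 n, gen 1 n * gen (n-1) n, gen 1 2 * gen 1 n, gen 1 n * gen 1 2}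
   \<union> {gen m (m+1) * gen l (l+1) - gen l (l+1) * gen m (m+1) | m l.
        1 \<le> m \<and> m \<le> l - 2 \<and> 3 \<le> l \<and> l \<le> n - 1}
   \<union> {gen m (m+1) * gen 1 n - gen 1 n * gen m (m+1) | m. 2 \<le> m \<and> m \<le> n - 2}"

lemma fk_relations_subset:
  assumes "n > 3"
  shows "fk_relations n \<subseteq> carrier (free_algebra (cycle_vars n) :: (var list \<Rightarrow>\<^sub>0 'f::field) ring)"
proof -
  interpret R: ring "free_algebra (cycle_vars n) :: (var list \<Rightarrow>\<^sub>0 'f) ring"
    by (rule ring_free_algebra)
  let ?C = "carrier (free_algebra (cycle_vars n) :: (var list \<Rightarrow>\<^sub>0 'f) ring)"
  have mult: "p * q \<in> ?C" if "p \<in> ?C" "q \<in> ?C" for p q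
    using R.m_closed[OF that] by (simp add: free_algebra_def)
  have diff: "p - q \<in> ?C" if "p \<in> ?C" "q \<in> ?C" for p q
    using that keys_diff[of p q] by (fastforce simp: free_algebra_def)
  have gen: "gen i j \<in> ?C" if "(i, j) \<in> cycle_vars n" for i j
    using that by (simp add: gen_def free_algebra_def)
  have step: "gen m (m+1) \<in> ?C" if "1 \<le> m" "m \<le> n - 1" for m
    by (rule gen) (use that in \<open>auto simp: cycle_vars_def\<close>)
  have step2: "gen (m+1) (m+2) \<in> ?C" if "1 \<le> m" "m \<le> n - 2" for m
    using step[of "m+1"] that assms by simp
  have ends: "gen 1 n \<in> ?C" "gen (n-1) n \<in> ?C" "gen 1 2 \<in> ?C"
    using gen[of 1 n] step[of "n-1"] step[of 1] assms by (auto simp: cycle_vars_def numeral_2_eq_2)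
  show ?thesis
    unfolding fk_relations_def
    using assms by (auto simp del: One_nat_def Suc_eq_plus1 add_2_eq_Suc'
        intro!: mult diff step step2 ends)
qed

definition fk_ideal :: "nat \<Rightarrow> (var list \<Rightarrow>\<^sub>0 'f::field) set" where
  "fk_ideal n = genideal (free_algebra (cycle_vars n)) (fk_relations n)"

definition fk_cycle :: "nat \<Rightarrow> (var list \<Rightarrow>\<^sub>0 'f::field) set ring" where
  "fk_cycle n = free_algebra (cycle_vars n) Quot fk_ideal n"

definition fk_class :: "nat \<Rightarrow> (var list \<Rightarrow>\<^sub>0 'f::field) \<Rightarrow> (var list \<Rightarrow>\<^sub>0 'f) set" where
  "fk_class n p = fk_ideal n +>\<^bsub>free_algebra (cycle_vars n)\<^esub> p"

text \<open>The copy of the ground field in the quotient algebra.\<close>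

definition fk_scalars :: "nat \<Rightarrow> (var list \<Rightarrow>\<^sub>0 'f::field) set set" where
  "fk_scalars n = range (\<lambda>c. fk_class n (Poly_Mapping.single [] c))"


section \<open>Monomial order and Groebner bases\<close>

text \<open>Pairs are listed as (smaller, larger): \<open>x\<^sub>i\<^sub>j > x\<^sub>k\<^sub>l\<close> iff \<open>j < l\<close>, or \<open>j = l\<close> and \<open>i > k\<close>.\<close>

definition var_less :: "(var \<times> var) set" where
  "var_less = {((k, l), (i, j)) | i j k l. j < l \<or> (j = l \<and> i > k)}"

text \<open>\<^const>\<open>lenlex\<close> compares lengths first and then lexicographically from the left.\<close>

definition word_less :: "(var list \<times> var list) set" where
  "word_less = lenlex var_less"

definition lead_word :: "(var list \<Rightarrow>\<^sub>0 'f::field) \<Rightarrow> var list" where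
  "lead_word p = (THE w. w \<in> Poly_Mapping.keys p \<and>
     (\<forall>u\<in>Poly_Mapping.keys p. u \<noteq> w \<longrightarrow> (u, w) \<in> word_less))"

definition groebner_basis ::
    "(var list \<Rightarrow>\<^sub>0 'f::field) set \<Rightarrow> (var list \<Rightarrow>\<^sub>0 'f) set \<Rightarrow> bool" where
  "groebner_basis I G \<longleftrightarrow> G \<subseteq> I - {0} \<and>
     (\<forall>f\<in>I - {0}. \<exists>g\<in>G. sublist (lead_word g) (lead_word f))"

lemma groebner_basis_exists: "groebner_basis I (I - {0})"
  unfolding groebner_basis_def by blast

lemma lead_word:
  assumes "p \<noteq> 0"
  shows "lead_word p \<in> Poly_Mapping.keys p"
    and "u \<in> Poly_Mapping.keys p \<Longrightarrow> u \<noteq> lead_word p \<Longrightarrow> (u, lead_word p) \<in> word_less"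
proof -
  have tr: "trans word_less"
    unfolding word_less_def by (rule lenlex_transI) (auto simp: var_less_def trans_def)
  have tot: "total word_less"
    unfolding word_less_def by (rule total_lenlex) (auto simp: var_less_def total_on_def)
  have irr: "irrefl word_less"
    unfolding word_less_def by (auto simp: irrefl_def lenlex_conv lex_conv var_less_def)
  let ?max = "\<lambda>S w. w \<in> S \<and> (\<forall>u\<in>S. u \<noteq> w \<longrightarrow> (u, w) \<in> word_less)"
  have ex: "\<exists>w. ?max S w" if "finite S" "S \<noteq> {}" for S
    using that
  proof (induction S rule: finite_ne_induct)
    case (insert a S)
    then obtain w where "?max S w" by blast
    show ?case
    proof (cases "a = w \<or> (a, w) \<in> word_less")
      case True
      with \<open>?max S w\<close> show ?thesis by (intro exI[of _ w]) auto
    next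
      case False
      then have "(w, a) \<in> word_less"
        using tot by (auto simp: total_on_def)
      with \<open>?max S w\<close> show ?thesis
        by (intro exI[of _ a]) (auto intro: transD[OF tr])
    qed
  qed simp
  have "\<exists>!w. ?max (Poly_Mapping.keys p) w"
    using ex[of "Poly_Mapping.keys p"] assms irr tr
    by (metis finite_keys irreflD keys_eq_empty transD)
  from theI'[OF this]
  show "lead_word p \<in> Poly_Mapping.keys p"
    and "u \<in> Poly_Mapping.keys p \<Longrightarrow> u \<noteq> lead_word p \<Longrightarrow> (u, lead_word p) \<in> word_less"
    unfolding lead_word_def by blast+
qed

definition normal_words :: "nat \<Rightarrow> (var list \<Rightarrow>\<^sub>0 'f::field) set \<Rightarrow> var list set" where
  "normal_words n G = {w \<in> lists (cycle_vars n). \<forall>g\<in>G. \<not> sublist (lead_word g) w}"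

text \<open>The basis determined by a Groebner basis \<open>G\<close> of \<open>fk_ideal n\<close>, as a set of
  elements of the quotient algebra.\<close>

definition fk_basis :: "nat \<Rightarrow> (var list \<Rightarrow>\<^sub>0 'f::field) set \<Rightarrow> (var list \<Rightarrow>\<^sub>0 'f) set set" where
  "fk_basis n G = (\<lambda>w. fk_class n (mon w)) ` normal_words n G"


section \<open>Matchings of the cycle graph\<close>

definition cycle_edges :: "nat \<Rightarrow> nat set set" where
  "cycle_edges n = {{m, m + 1} | m. 1 \<le> m \<and> m \<le> n - 1} \<union> {{1, n}}"

definition matchings :: "'v set set \<Rightarrow> 'v set set set" where
  "matchings E = {M. M \<subseteq> E \<and> pairwise disjnt M}"

end

theory Submission
  imports Defs "HOL-Combinatorics.Multiset_Permutations"
begin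

text \<open>The relations say exactly this: letters with a common vertex (in particular equal letters)
  multiply to zero, and all other pairs of letters commute. Hence modulo the ideal a word depends
  only on its multiset of letters (\<open>rearrange_mem_fk_ideal\<close>), and it vanishes unless its letters are
  distinct and form a matching (\<open>mon_mem_fk_ideal\<close>). So one word for each matching suffices to span
  the quotient; the natural choice is the least word with the given letters, called standard below.

  The other half is that these words stay independent. For a set \<open>S\<close> of letters let
  \<open>set_coeff S p\<close> be the sum of the coefficients in \<open>p\<close> of all arrangements of \<open>S\<close>. On products it
  obeys \<open>set_coeff S (p * q) = (\<Sum>T\<subseteq>S. set_coeff T p * set_coeff (S - T) q)\<close>. Since subsets of
  matchings are matchings, the elements killed by \<open>set_coeff S\<close> for every matching \<open>S\<close> therefore
  form a two-sided ideal; it contains the relations, hence all of the ideal of the algebra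
  (\<open>set_coeff_fk_ideal\<close>), whereas \<open>set_coeff S\<close> is 1 on an arrangement of \<open>S\<close>.

  Both halves also identify the normal words of an arbitrary Groebner basis with the standard words
  (\<open>normal_words_eq_standard_words\<close>). A word that is not standard is the leading word of
  an element of the ideal, either of the word itself or of its difference with a smaller arrangement.
  Conversely, a leading word \<open>u\<close> of an element \<open>g\<close> of the ideal cannot occur in a standard word:
  as \<open>set_coeff\<close> vanishes at \<open>g\<close>, a second, smaller arrangement of the letters of \<open>u\<close> occurs in \<open>g\<close>,
  and putting it in the place of \<open>u\<close> makes the standard word smaller.\<close>


section \<open>Reading off the coefficient of a set of letters\<close>

lemma update_eq_plus_single:
  "k \<notin> Poly_Mapping.keys p \<Longrightarrow> Poly_Mapping.update k v p = p + Poly_Mapping.single k v"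
  by (intro poly_mapping_eqI)
    (auto simp: lookup_add lookup_single Poly_Mapping.lookup_update when_def in_keys_iff)

text \<open>This is the coefficient of the squarefree monomial \<open>\<Prod>S\<close> in the image of \<open>p\<close> under the map to
  commutative polynomials.\<close>

definition set_coeff :: "'x set \<Rightarrow> ('x list \<Rightarrow>\<^sub>0 'f::field) \<Rightarrow> 'f" where
  "set_coeff S p = (\<Sum>w\<in>permutations_of_set S. Poly_Mapping.lookup p w)"

lemma set_coeff_zero [simp]: "set_coeff S 0 = 0"
  by (simp add: set_coeff_def)

lemma set_coeff_add: "set_coeff S (p + q) = set_coeff S p + set_coeff S q"
  by (simp add: set_coeff_def lookup_add sum.distrib)

lemma set_coeff_diff: "set_coeff S (p - q) = set_coeff S p - set_coeff S q"
  by (simp add: set_coeff_def lookup_minus sum_subtractf)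

lemma set_coeff_uminus: "set_coeff S (- p) = - set_coeff S p"
  using set_coeff_diff[of S 0 p] by simp

lemma set_coeff_single:
  "set_coeff S (Poly_Mapping.single w c) = (if w \<in> permutations_of_set S then c else 0)"
  by (simp add: set_coeff_def lookup_single when_def)

text \<open>The rule for the coefficient of a squarefree monomial in a product of commutative
  polynomials. Both sides are biadditive, so it is enough to compare them on words \<open>u\<close> and \<open>v\<close>,
  where only \<open>T = set u\<close> contributes.\<close>

lemma set_coeff_mult:
  assumes "finite S"
  shows "set_coeff S (p * q) = (\<Sum>T\<in>Pow S. set_coeff T p * set_coeff (S - T) q)"
proof -
  have single: "set_coeff S (Poly_Mapping.single u a * Poly_Mapping.single v b) =
      (\<Sum>T\<in>Pow S. set_coeff T (Poly_Mapping.single u a) * set_coeff (S - T) (Poly_Mapping.single v b))"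
    (is "?l = ?r") for u v :: "'a list" and a b :: 'b
  proof -
    have "?r = (\<Sum>T\<in>Pow S. if T = set u
        then (if distinct u \<and> v \<in> permutations_of_set (S - set u) then a * b else 0) else 0)"
      by (rule sum.cong) (auto simp: set_coeff_single permutations_of_set_def)
    also have "\<dots> = (if set u \<subseteq> S \<and> distinct u \<and> v \<in> permutations_of_set (S - set u)
        then a * b else 0)"
      using assms by (auto simp: sum.delta)
    also have "\<dots> = ?l"
      by (auto simp: mult_single plus_list_def set_coeff_single permutations_of_set_def)
    finally show ?thesis by simp
  qed
  have left: "set_coeff S (Poly_Mapping.single u a * q) =
      (\<Sum>T\<in>Pow S. set_coeff T (Poly_Mapping.single u a) * set_coeff (S - T) q)"
    for u :: "'a list" and a :: 'b and q
  proof (induction q rule: update_induct)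
    case (update f v b)
    then show ?case
      by (simp add: update_eq_plus_single distrib_left set_coeff_add sum.distrib single)
  qed simp
  show ?thesis
  proof (induction p rule: update_induct)
    case (update f v b)
    then show ?case
      by (simp add: update_eq_plus_single distrib_right set_coeff_add sum.distrib left)
  qed simp
qed


section \<open>The relations in terms of edges\<close>

definition edge :: "var \<Rightarrow> nat set" where
  "edge x = {fst x, snd x}"

definition matching_letters :: "nat \<Rightarrow> var set \<Rightarrow> bool" where
  "matching_letters n S \<longleftrightarrow>
     S \<subseteq> cycle_vars n \<and> pairwise (\<lambda>x y. disjnt (edge x) (edge y)) S"

lemma cycle_vars_less: "n > 1 \<Longrightarrow> x \<in> cycle_vars n \<Longrightarrow> fst x < snd x"
  unfolding cycle_vars_def by auto

text \<open>An edge determines its letter because a letter lists the smaller vertex first.\<close>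

lemma edge_inj:
  assumes "n > 1"
  shows "inj_on edge (cycle_vars n)"
proof (rule inj_onI)
  fix x y assume "x \<in> cycle_vars n" "y \<in> cycle_vars n" "edge x = edge y"
  with cycle_vars_less[OF assms, of x] cycle_vars_less[OF assms, of y] show "x = y"
    unfolding edge_def doubleton_eq_iff prod_eq_iff by linarith
qed

lemma edge_image_cycle_vars: "edge ` cycle_vars n = cycle_edges n"
  by (auto simp: edge_def cycle_vars_def cycle_edges_def image_def)

lemma finite_cycle_vars: "finite (cycle_vars n)"
proof -
  have "cycle_vars n \<subseteq> {..n} \<times> {..n} \<union> {(1, n)}"
    by (auto simp: cycle_vars_def)
  then show ?thesis by (rule finite_subset) simp
qed

lemma matching_letters_subset:
  "matching_letters n S \<Longrightarrow> T \<subseteq> S \<Longrightarrow> matching_letters n T"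
  unfolding matching_letters_def by (blast intro: pairwise_subset)

lemma finite_matching_letters: "matching_letters n S \<Longrightarrow> finite S"
  using finite_cycle_vars finite_subset by (auto simp: matching_letters_def)

lemma mon_mult: "(mon u :: 'x list \<Rightarrow>\<^sub>0 'f::field) * mon v = mon (u @ v)"
  by (simp add: mult_single plus_list_def)

lemma gen_mult: "(gen i j :: var list \<Rightarrow>\<^sub>0 'f::field) * gen k l = mon [(i, j), (k, l)]"
  by (simp add: gen_def mon_mult)

text \<open>The next three lemmas replace the list of relations by the two types of relations between
  letters, so that no index arithmetic is needed afterwards.\<close>

lemma fk_relations_cases:
  assumes "n > 3" and "(r :: var list \<Rightarrow>\<^sub>0 'f::field) \<in> fk_relations n"
  obtains (zero) x y where "x \<in> cycle_vars n" "y \<in> cycle_vars n" "\<not> disjnt (edge x) (edge y)"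
      "r = mon [x, y]"
    | (comm) x y where "x \<in> cycle_vars n" "y \<in> cycle_vars n" "r = mon [x, y] - mon [y, x]"
proof -
  have step: "(m, m + 1) \<in> cycle_vars n" if "1 \<le> m" "m \<le> n - 1" for m
    using that by (auto simp: cycle_vars_def)
  have ends: "(1, n) \<in> cycle_vars n" "(n - 1, n) \<in> cycle_vars n" "(1, 2) \<in> cycle_vars n"
    using assms(1) step[of "n - 1"] step[of 1]
    by (auto simp: cycle_vars_def numeral_2_eq_2)
  have step2: "(m + 1, m + 2) \<in> cycle_vars n" if "1 \<le> m" "m \<le> n - 2" for m
    using step[of "m + 1"] that assms(1) by simp
  have zero': ?thesis if "r = mon [x, y]" "x \<in> cycle_vars n" "y \<in> cycle_vars n"
      "edge x \<inter> edge y \<noteq> {}" for x y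
    using that by (intro zero) (auto simp: disjnt_def)
  from assms(2) show ?thesis
    unfolding fk_relations_def gen_mult Un_iff insert_iff mem_Collect_eq empty_iff simp_thms
  proof (elim disjE exE conjE, goal_cases)
    case (1 m)
    then show ?case using step[of m] by (intro zero'[of "(m, m+1)" "(m, m+1)"]) (auto simp: edge_def)
  next
    case 2
    then show ?case using ends by (intro zero'[of "(1, n)" "(1, n)"]) (auto simp: edge_def)
  next
    case (3 m)
    then show ?case using step[of m] step2[of m]
      by (intro zero'[of "(m, m+1)" "(m+1, m+2)"]) (auto simp: edge_def)
  next
    case (4 m)
    then show ?case using step[of m] step2[of m]
      by (intro zero'[of "(m+1, m+2)" "(m, m+1)"]) (auto simp: edge_def)
  next
    case 5
    then show ?case using ends by (intro zero'[of "(n-1, n)" "(1, n)"]) (auto simp: edge_def)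
  next
    case 6
    then show ?case using ends by (intro zero'[of "(1, n)" "(n-1, n)"]) (auto simp: edge_def)
  next
    case 7
    then show ?case using ends by (intro zero'[of "(1, 2)" "(1, n)"]) (auto simp: edge_def)
  next
    case 8
    then show ?case using ends by (intro zero'[of "(1, n)" "(1, 2)"]) (auto simp: edge_def)
  next
    case (9 m l)
    then show ?case using step[of m] step[of l] by (intro comm[of "(m, m+1)" "(l, l+1)"]) auto
  next
    case (10 m)
    then show ?case using step[of m] ends by (intro comm[of "(m, m+1)" "(1, n)"]) auto
  qed
qed

lemma mon_mem_fk_relations:
  assumes "n > 3" "x \<in> cycle_vars n" "y \<in> cycle_vars n" "\<not> disjnt (edge x) (edge y)"
  shows "(mon [x, y] :: var list \<Rightarrow>\<^sub>0 'f::field) \<in> fk_relations n"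
proof -
  have a: "(mon [(m, m+1), (m, m+1)] :: var list \<Rightarrow>\<^sub>0 'f) \<in> fk_relations n"
    if "1 \<le> m" "m \<le> n - 1" for m
    using that unfolding fk_relations_def gen_mult by blast
  have b: "(mon [(m, m+1), (m+1, m+1+1)] :: var list \<Rightarrow>\<^sub>0 'f) \<in> fk_relations n"
    "(mon [(m+1, m+1+1), (m, m+1)] :: var list \<Rightarrow>\<^sub>0 'f) \<in> fk_relations n"
    if "1 \<le> m" "m + 1 \<le> n - 1" for m
  proof -
    have "m \<le> n - 2" "m + 1 + 1 = m + 2" using that by auto
    then show "(mon [(m, m+1), (m+1, m+1+1)] :: var list \<Rightarrow>\<^sub>0 'f) \<in> fk_relations n"
      "(mon [(m+1, m+1+1), (m, m+1)] :: var list \<Rightarrow>\<^sub>0 'f) \<in> fk_relations n"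
      using that(1) unfolding fk_relations_def gen_mult \<open>m + 1 + 1 = m + 2\<close> by blast+
  qed
  have c: "(mon [(1, n), (1, n)] :: var list \<Rightarrow>\<^sub>0 'f) \<in> fk_relations n"
    unfolding fk_relations_def gen_mult by blast
  have d: "(mon [(m, m+1), (1, n)] :: var list \<Rightarrow>\<^sub>0 'f) \<in> fk_relations n"
    "(mon [(1, n), (m, m+1)] :: var list \<Rightarrow>\<^sub>0 'f) \<in> fk_relations n"
    if "m = 1 \<or> m = n - 1" for m
  proof -
    have mem: "(mon [(1, 2), (1, n)] :: var list \<Rightarrow>\<^sub>0 'f) \<in> fk_relations n"
      "(mon [(1, n), (1, 2)] :: var list \<Rightarrow>\<^sub>0 'f) \<in> fk_relations n"
      "(mon [(n-1, n), (1, n)] :: var list \<Rightarrow>\<^sub>0 'f) \<in> fk_relations n"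
      "(mon [(1, n), (n-1, n)] :: var list \<Rightarrow>\<^sub>0 'f) \<in> fk_relations n"
      unfolding fk_relations_def gen_mult by blast+
    have "(m, m + 1) = (1, 2) \<or> (m, m + 1) = (n - 1, n)"
      using that assms(1) by auto
    with mem show "(mon [(m, m+1), (1, n)] :: var list \<Rightarrow>\<^sub>0 'f) \<in> fk_relations n"
      "(mon [(1, n), (m, m+1)] :: var list \<Rightarrow>\<^sub>0 'f) \<in> fk_relations n"
      by metis+
  qed
  have split: "(\<exists>m. x = (m, m+1) \<and> 1 \<le> m \<and> m \<le> n - 1) \<or> x = (1, n)"
    "(\<exists>m. y = (m, m+1) \<and> 1 \<le> m \<and> m \<le> n - 1) \<or> y = (1, n)"
    using assms(2,3) by (auto simp: cycle_vars_def)
  then consider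
      m l where "x = (m, m+1)" "y = (l, l+1)" "1 \<le> m" "m \<le> n - 1" "1 \<le> l" "l \<le> n - 1"
    | m where "x = (m, m+1)" "y = (1, n)" "1 \<le> m" "m \<le> n - 1"
    | l where "x = (1, n)" "y = (l, l+1)" "1 \<le> l" "l \<le> n - 1"
    | "x = (1, n)" "y = (1, n)"
    by (elim disjE exE conjE) simp_all
  then show ?thesis
  proof cases
    case (1 m l)
    then have "l = m \<or> l = m + 1 \<or> m = l + 1"
      using assms(4) by (auto simp: edge_def disjnt_def)
    then show ?thesis using 1 a[of m] b[of m] b[of l] by auto
  next
    case (2 m)
    then have "m = 1 \<or> m = n - 1"
      using assms(1,4) by (auto simp: edge_def disjnt_def)
    then show ?thesis using 2 d[of m] by simp
  next
    case (3 m)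
    then have "m = 1 \<or> m = n - 1"
      using assms(1,4) by (auto simp: edge_def disjnt_def)
    then show ?thesis using 3 d[of m] by simp
  next
    case 4
    then show ?thesis using c by simp
  qed
qed

lemma commutator_mem_fk_relations:
  assumes "n > 3" "x \<in> cycle_vars n" "y \<in> cycle_vars n" "disjnt (edge x) (edge y)"
  shows "(mon [x, y] - mon [y, x] :: var list \<Rightarrow>\<^sub>0 'f::field) \<in> fk_relations n \<or>
    (mon [y, x] - mon [x, y] :: var list \<Rightarrow>\<^sub>0 'f) \<in> fk_relations n"
proof -
  have a: "(mon [(m, m+1), (l, l+1)] - mon [(l, l+1), (m, m+1)] :: var list \<Rightarrow>\<^sub>0 'f)
      \<in> fk_relations n" if "1 \<le> m" "m + 2 \<le> l" "l \<le> n - 1" for m l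
  proof -
    have "m \<le> l - 2" "3 \<le> l" using that by auto
    then show ?thesis using that unfolding fk_relations_def gen_mult by blast
  qed
  have b: "(mon [(m, m+1), (1, n)] - mon [(1, n), (m, m+1)] :: var list \<Rightarrow>\<^sub>0 'f)
      \<in> fk_relations n" if "2 \<le> m" "m \<le> n - 2" for m
    using that unfolding fk_relations_def gen_mult by blast
  have split: "(\<exists>m. x = (m, m+1) \<and> 1 \<le> m \<and> m \<le> n - 1) \<or> x = (1, n)"
    "(\<exists>m. y = (m, m+1) \<and> 1 \<le> m \<and> m \<le> n - 1) \<or> y = (1, n)"
    using assms(2,3) by (auto simp: cycle_vars_def)
  then consider
      m l where "x = (m, m+1)" "y = (l, l+1)" "1 \<le> m" "m \<le> n - 1" "1 \<le> l" "l \<le> n - 1"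
    | m where "x = (m, m+1)" "y = (1, n)" "1 \<le> m" "m \<le> n - 1"
    | l where "x = (1, n)" "y = (l, l+1)" "1 \<le> l" "l \<le> n - 1"
    | "x = (1, n)" "y = (1, n)"
    by (elim disjE exE conjE) simp_all
  then show ?thesis
  proof cases
    case (1 m l)
    then have "m + 2 \<le> l \<or> l + 2 \<le> m"
      using assms(4) by (auto simp: edge_def disjnt_def)
    then show ?thesis using 1 a[of m l] a[of l m] by auto
  next
    case (2 m)
    then have "2 \<le> m" "m \<le> n - 2"
      using assms(4) by (auto simp: edge_def disjnt_def)
    then show ?thesis using 2 b[of m] by simp
  next
    case (3 m)
    then have "2 \<le> m" "m \<le> n - 2"
      using assms(4) by (auto simp: edge_def disjnt_def)
    then show ?thesis using 3 b[of m] by simp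
  next
    case 4
    then show ?thesis using assms(4) by (simp add: edge_def)
  qed
qed


section \<open>The ideal\<close>

lemma mem_carrier_free_algebra:
  "p \<in> carrier (free_algebra X) \<longleftrightarrow> Poly_Mapping.keys p \<subseteq> lists X"
  by (simp add: free_algebra_def)

lemma mon_mem_carrier:
  "(mon w :: 'x list \<Rightarrow>\<^sub>0 'f::field) \<in> carrier (free_algebra X) \<longleftrightarrow> w \<in> lists X"
  by (simp add: mem_carrier_free_algebra)

lemma free_algebra_simps [simp]:
  "p \<oplus>\<^bsub>free_algebra X\<^esub> q = p + q" "p \<otimes>\<^bsub>free_algebra X\<^esub> q = p * q"
  "\<zero>\<^bsub>free_algebra X\<^esub> = 0" "\<one>\<^bsub>free_algebra X\<^esub> = 1"
  by (simp_all add: free_algebra_def)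

lemma free_algebra_minus:
  fixes p :: "'x list \<Rightarrow>\<^sub>0 'f::field"
  assumes "p \<in> carrier (free_algebra X)"
  shows "\<ominus>\<^bsub>free_algebra X\<^esub> p = - p"
proof -
  interpret R: ring "free_algebra X :: ('x list \<Rightarrow>\<^sub>0 'f) ring" by (rule ring_free_algebra)
  show ?thesis
    using assms by (intro R.minus_equality) (auto simp: mem_carrier_free_algebra)
qed

lemma ideal_fk_ideal:
  assumes "n > 3"
  shows "ideal (fk_ideal n) (free_algebra (cycle_vars n) :: (var list \<Rightarrow>\<^sub>0 'f::field) ring)"
  unfolding fk_ideal_def
  by (rule ring.genideal_ideal[OF ring_free_algebra fk_relations_subset[OF assms]])

lemma fk_relation_mem_fk_ideal:
  assumes "n > 3" "r \<in> fk_relations n"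
  shows "r \<in> fk_ideal n"
  unfolding fk_ideal_def
  using ring.genideal_self[OF ring_free_algebra fk_relations_subset[OF assms(1)]] assms(2) by blast

lemma fk_ideal_zero: "n > 3 \<Longrightarrow> (0 :: var list \<Rightarrow>\<^sub>0 'f::field) \<in> fk_ideal n"
  using additive_subgroup.zero_closed[OF ideal.axioms(1)[OF ideal_fk_ideal]] by simp

lemma fk_ideal_add: "n > 3 \<Longrightarrow> p \<in> fk_ideal n \<Longrightarrow> q \<in> fk_ideal n \<Longrightarrow> p + q \<in> fk_ideal n"
  using additive_subgroup.a_closed[OF ideal.axioms(1)[OF ideal_fk_ideal]] by fastforce

lemma fk_ideal_uminus:
  assumes "n > 3" "(p :: var list \<Rightarrow>\<^sub>0 'f::field) \<in> fk_ideal n"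
  shows "- p \<in> fk_ideal n"
proof -
  interpret ideal "fk_ideal n" "free_algebra (cycle_vars n) :: (var list \<Rightarrow>\<^sub>0 'f) ring"
    by (rule ideal_fk_ideal[OF assms(1)])
  show ?thesis
    using additive_subgroup.a_inv_closed[OF additive_subgroup_axioms assms(2)]
      free_algebra_minus[OF Icarr[OF assms(2)]] by simp
qed

lemma fk_ideal_diff:
  "n > 3 \<Longrightarrow> p \<in> fk_ideal n \<Longrightarrow> q \<in> fk_ideal n \<Longrightarrow> p - q \<in> fk_ideal n"
  using fk_ideal_add[of n p "- q"] fk_ideal_uminus[of n q] by simp

lemma fk_ideal_mult_left:
  "n > 3 \<Longrightarrow> p \<in> fk_ideal n \<Longrightarrow> a \<in> carrier (free_algebra (cycle_vars n)) \<Longrightarrow> a * p \<in> fk_ideal n"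
  using ideal.I_l_closed[OF ideal_fk_ideal] by fastforce

lemma fk_ideal_mult_right:
  "n > 3 \<Longrightarrow> p \<in> fk_ideal n \<Longrightarrow> a \<in> carrier (free_algebra (cycle_vars n)) \<Longrightarrow> p * a \<in> fk_ideal n"
  using ideal.I_r_closed[OF ideal_fk_ideal] by fastforce

lemma set_coeff_fk_relation:
  assumes "n > 3" "r \<in> fk_relations n" "matching_letters n S"
  shows "set_coeff S r = 0"
  using assms(1,2)
proof (cases rule: fk_relations_cases)
  case (zero x y)
  have "[x, y] \<notin> permutations_of_set S"
  proof
    assume "[x, y] \<in> permutations_of_set S"
    then have "x \<in> S" "y \<in> S" "x \<noteq> y" by (auto simp: permutations_of_set_def)
    then show False using assms(3) zero(3) by (auto simp: matching_letters_def pairwise_def)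
  qed
  then show ?thesis by (simp add: zero(4) set_coeff_single)
next
  case (comm x y)
  have "[x, y] \<in> permutations_of_set S \<longleftrightarrow> [y, x] \<in> permutations_of_set S"
    by (auto simp: permutations_of_set_def)
  then show ?thesis by (simp add: comm(3) set_coeff_diff set_coeff_single)
qed

text \<open>The common kernel of the functionals \<open>set_coeff S\<close> for matchings \<open>S\<close> is a two-sided ideal by
  \<open>set_coeff_mult\<close>, because the sets \<open>T\<close> and \<open>S - T\<close> in that formula are again matchings.\<close>

lemma set_coeff_fk_ideal:
  assumes "n > 3" "(p :: var list \<Rightarrow>\<^sub>0 'f::field) \<in> fk_ideal n" "matching_letters n S"
  shows "set_coeff S p = 0"
proof -
  let ?R = "free_algebra (cycle_vars n) :: (var list \<Rightarrow>\<^sub>0 'f) ring"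
  let ?J = "{p \<in> carrier ?R. \<forall>S. matching_letters n S \<longrightarrow> set_coeff S p = 0}"
  interpret R: ring ?R by (rule ring_free_algebra)
  have closed: "p + q \<in> carrier ?R" "p * q \<in> carrier ?R"
    if "p \<in> carrier ?R" "q \<in> carrier ?R" for p q
    using R.a_closed[OF that] R.m_closed[OF that] by simp_all
  have uminus: "- p \<in> carrier ?R" if "p \<in> carrier ?R" for p
    using R.a_inv_closed[OF that] free_algebra_minus[OF that] by simp
  have "ideal ?J ?R"
  proof (rule idealI)
    show "ring ?R" by (rule R.ring_axioms)
    show "subgroup ?J (add_monoid ?R)"
    proof
      fix p assume p: "p \<in> ?J"
      then have "inv\<^bsub>add_monoid ?R\<^esub> p = - p"
        using free_algebra_minus[of p "cycle_vars n"] by (simp add: a_inv_def)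
      then show "inv\<^bsub>add_monoid ?R\<^esub> p \<in> ?J"
        using p uminus[of p] by (simp add: set_coeff_uminus)
    next
      fix p q assume "p \<in> ?J" "q \<in> ?J"
      then show "p \<otimes>\<^bsub>add_monoid ?R\<^esub> q \<in> ?J"
        using closed(1) by (simp add: set_coeff_add)
    qed (use R.zero_closed in auto)
  next
    fix a x assume "a \<in> ?J" "x \<in> carrier ?R"
    then show "x \<otimes>\<^bsub>?R\<^esub> a \<in> ?J" "a \<otimes>\<^bsub>?R\<^esub> x \<in> ?J"
      using closed(2) matching_letters_subset
      by (auto simp: set_coeff_mult finite_matching_letters intro!: sum.neutral)
  qed
  moreover have "fk_relations n \<subseteq> ?J"
    using fk_relations_subset[OF assms(1)] set_coeff_fk_relation[OF assms(1)] by blast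
  ultimately have "fk_ideal n \<subseteq> ?J"
    unfolding fk_ideal_def by (rule R.genideal_minimal)
  then show ?thesis using assms(2,3) by blast
qed

text \<open>Letters with a common vertex commute as well, since both products lie in the ideal.\<close>

lemma commutator_mem_fk_ideal:
  assumes "n > 3" "x \<in> cycle_vars n" "y \<in> cycle_vars n"
  shows "(mon [x, y] - mon [y, x] :: var list \<Rightarrow>\<^sub>0 'f::field) \<in> fk_ideal n"
proof (cases "disjnt (edge x) (edge y)")
  case True
  then show ?thesis
    using commutator_mem_fk_relations[OF assms True, where 'f = 'f] fk_relation_mem_fk_ideal[OF assms(1)]
      fk_ideal_uminus[OF assms(1), of "mon [y, x] - mon [x, y]"] by fastforce
next
  case False
  then have "\<not> disjnt (edge y) (edge x)" by (simp add: disjnt_def Int_commute)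
  with False show ?thesis
    using assms by (intro fk_ideal_diff fk_relation_mem_fk_ideal mon_mem_fk_relations) auto
qed

lemma rearrange_mem_fk_ideal:
  assumes "n > 3" "mset u = mset v" "u \<in> lists (cycle_vars n)"
  shows "(mon u - mon v :: var list \<Rightarrow>\<^sub>0 'f::field) \<in> fk_ideal n"
  using assms(2,3)
proof (induction u arbitrary: v)
  case Nil
  then show ?case using fk_ideal_zero[OF assms(1)] by simp
next
  case (Cons x u)
  (* a letter can be moved to the front of any word *)
  have front: "(mon (x # a @ b) - mon (a @ x # b) :: var list \<Rightarrow>\<^sub>0 'f) \<in> fk_ideal n"
    if "set a \<subseteq> cycle_vars n" "set b \<subseteq> cycle_vars n" for a b
    using that
  proof (induction a)
    case Nil
    then show ?case using fk_ideal_zero[OF assms(1)] by simp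
  next
    case (Cons y a)
    have "(mon [x, y] - mon [y, x]) * mon (a @ b) \<in> (fk_ideal n :: (var list \<Rightarrow>\<^sub>0 'f) set)"
      using Cons.prems \<open>x # u \<in> lists (cycle_vars n)\<close>
      by (intro fk_ideal_mult_right commutator_mem_fk_ideal assms(1)) (auto simp: mon_mem_carrier)
    moreover have "mon [y] * (mon (x # a @ b) - mon (a @ x # b)) \<in> (fk_ideal n :: (var list \<Rightarrow>\<^sub>0 'f) set)"
      using Cons by (intro fk_ideal_mult_left assms(1)) (auto simp: mon_mem_carrier)
    ultimately show ?case
      using fk_ideal_add[OF assms(1)]
      by (fastforce simp: left_diff_distrib right_diff_distrib mon_mult)
  qed
  have "x \<in> set v" using Cons.prems(1) by (metis list.set_intros(1) set_mset_mset)
  then obtain a b where v: "v = a @ x # b" by (auto dest: split_list)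
  have sub: "set v \<subseteq> cycle_vars n"
    using Cons.prems by (metis in_lists_conv_set set_mset_mset subsetI)
  have "(mon u - mon (a @ b) :: var list \<Rightarrow>\<^sub>0 'f) \<in> fk_ideal n"
    using Cons.prems by (intro Cons.IH) (auto simp: v)
  then have "mon [x] * (mon u - mon (a @ b)) \<in> (fk_ideal n :: (var list \<Rightarrow>\<^sub>0 'f) set)"
    using Cons.prems by (intro fk_ideal_mult_left assms(1)) (auto simp: mon_mem_carrier)
  then have "(mon (x # u) - mon (x # a @ b) :: var list \<Rightarrow>\<^sub>0 'f) \<in> fk_ideal n"
    by (simp add: right_diff_distrib mon_mult)
  moreover have "(mon (x # a @ b) - mon v :: var list \<Rightarrow>\<^sub>0 'f) \<in> fk_ideal n"
    using front[of a b] sub by (simp add: v)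
  ultimately show ?case
    using fk_ideal_add[OF assms(1)] by fastforce
qed

text \<open>Two letters with a common vertex, possibly two copies of the same letter, can be moved to the
  front, where their product is a relation.\<close>

lemma mon_mem_fk_ideal:
  assumes "n > 3" "w \<in> lists (cycle_vars n)" "\<not> (distinct w \<and> matching_letters n (set w))"
  shows "(mon w :: var list \<Rightarrow>\<^sub>0 'f::field) \<in> fk_ideal n"
proof -
  have "\<exists>x y r. mset w = mset (x # y # r) \<and> \<not> disjnt (edge x) (edge y)"
  proof (cases "distinct w")
    case False
    then obtain a b c x where "w = a @ [x] @ b @ [x] @ c"
      by (auto dest: not_distinct_decomp)
    then show ?thesis
      by (intro exI[of _ x] exI[of _ "a @ b @ c"]) (simp add: edge_def)
  next
    case True
    with assms(2,3) obtain x y where xy: "x \<in> set w" "y \<in> set w" "x \<noteq> y"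
        "\<not> disjnt (edge x) (edge y)"
      by (auto simp: matching_letters_def pairwise_def)
    then obtain a b where w: "w = a @ x # b" by (auto dest: split_list)
    with xy have "y \<in> set (a @ b)" by auto
    then obtain c d where "a @ b = c @ y # d" by (metis split_list)
    then have "mset (a @ b) = mset (c @ y # d)" by simp
    then have "mset w = mset (x # y # c @ d)" by (simp add: w)
    with xy(4) show ?thesis by blast
  qed
  then obtain x y r where r: "mset w = mset (x # y # r)" "\<not> disjnt (edge x) (edge y)" by blast
  from r(1) have "set w = set (x # y # r)" by (rule mset_eq_setD)
  with assms(2) have sub: "set (x # y # r) \<subseteq> cycle_vars n" by auto
  then have "mon [x, y] * mon r \<in> (fk_ideal n :: (var list \<Rightarrow>\<^sub>0 'f) set)"
    using r(2) by (intro fk_ideal_mult_right fk_relation_mem_fk_ideal mon_mem_fk_relations assms(1))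
      (auto simp: mon_mem_carrier)
  then have "(mon (x # y # r) :: var list \<Rightarrow>\<^sub>0 'f) \<in> fk_ideal n" by (simp add: mon_mult)
  with fk_ideal_add[OF assms(1) rearrange_mem_fk_ideal[OF assms(1) r(1) assms(2), where 'f = 'f]]
  show ?thesis by fastforce
qed


section \<open>Normal words\<close>

lemma trans_word_less: "trans word_less"
  unfolding word_less_def by (rule lenlex_transI) (auto simp: var_less_def trans_def)

lemma total_word_less: "total word_less"
  unfolding word_less_def by (rule total_lenlex) (auto simp: var_less_def total_on_def)

lemma irrefl_var_less: "irrefl var_less"
  by (auto simp: var_less_def irrefl_def)

lemma word_less_irrefl: "(w, w) \<notin> word_less"
  unfolding word_less_def by (rule lenlex_irreflexive) (auto simp: var_less_def)

lemma word_less_append: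
  assumes "(u, v) \<in> word_less" "length u = length v"
  shows "(a @ u @ b, a @ v @ b) \<in> word_less"
  using assms lenlex_append1[of u v var_less b b]
  by (simp add: word_less_def lenlex_append2[OF irrefl_var_less])

text \<open>Being least among the arrangements of a set of letters means being increasing in the order of
  the variables. Minimality is the form in which the property interacts with leading words, and it
  passes to contiguous subwords because \<open>word_less\<close> is compatible with concatenation.\<close>

definition standard_words :: "nat \<Rightarrow> var list set" where
  "standard_words n = {w. distinct w \<and> matching_letters n (set w) \<and>
     (\<forall>v\<in>permutations_of_set (set w). (v, w) \<notin> word_less)}"

lemma standard_words_unique:
  assumes "v \<in> standard_words n" "w \<in> standard_words n" "set v = set w"
  shows "v = w"
proof (rule ccontr)
  assume "v \<noteq> w"
  then have "(v, w) \<in> word_less \<or> (w, v) \<in> word_less"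
    using total_word_less by (auto simp: total_on_def)
  with assms show False
    by (auto simp: standard_words_def permutations_of_set_def)
qed

lemma standard_words_exists:
  assumes "matching_letters n S"
  obtains w where "w \<in> standard_words n" "set w = S"
proof -
  have "permutations_of_set S \<noteq> {}"
    using finite_matching_letters[OF assms] by simp
  moreover have "asymp_on (permutations_of_set S) (\<lambda>u v. (u, v) \<in> word_less)"
    using trans_word_less word_less_irrefl by (auto simp: asymp_on_def dest: transD)
  moreover have "transp_on (permutations_of_set S) (\<lambda>u v. (u, v) \<in> word_less)"
    using trans_word_less by (auto simp: transp_on_def dest: transD)
  ultimately obtain w where "w \<in> permutations_of_set S"
      "\<forall>v\<in>permutations_of_set S. v \<noteq> w \<longrightarrow> (v, w) \<notin> word_less"
    using Finite_Set.bex_min_element[of "permutations_of_set S" "\<lambda>u v. (u, v) \<in> word_less"] by auto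
  with assms word_less_irrefl show ?thesis
    by (intro that[of w]) (auto simp: standard_words_def permutations_of_set_def)
qed

lemma standard_words_lists: "standard_words n \<subseteq> lists (cycle_vars n)"
  by (auto simp: standard_words_def matching_letters_def)

text \<open>The right-hand side does not mention \<open>G\<close>: the normal words are the words that are not leading
  words of elements of the ideal, whichever Groebner basis is used.\<close>

lemma normal_words_eq_standard_words:
  assumes "n > 3" "groebner_basis (fk_ideal n) (G :: (var list \<Rightarrow>\<^sub>0 'f::field) set)"
  shows "normal_words n G = standard_words n"
proof (intro equalityI subsetI)
  fix w assume w: "w \<in> normal_words n G"
  then have lists: "w \<in> lists (cycle_vars n)" by (simp add: normal_words_def)
  have no_lead: "f \<notin> fk_ideal n" if "f \<noteq> 0" "lead_word f = w" for f :: "var list \<Rightarrow>\<^sub>0 'f"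
    using assms(2) w that by (auto simp: groebner_basis_def normal_words_def)
  have "mon w \<notin> (fk_ideal n :: (var list \<Rightarrow>\<^sub>0 'f) set)"
  proof -
    have nz: "(mon w :: var list \<Rightarrow>\<^sub>0 'f) \<noteq> 0"
      by (metis lookup_single_eq lookup_zero zero_neq_one)
    then show ?thesis using no_lead[OF nz] lead_word(1)[OF nz] by simp
  qed
  with mon_mem_fk_ideal[OF assms(1) lists] have good: "distinct w" "matching_letters n (set w)"
    by blast+
  have "(v, w) \<notin> word_less" if v: "v \<in> permutations_of_set (set w)" for v
  proof
    assume less: "(v, w) \<in> word_less"
    let ?f = "mon w - mon v :: var list \<Rightarrow>\<^sub>0 'f"
    from less word_less_irrefl have ne: "v \<noteq> w" by auto
    then have keys: "Poly_Mapping.keys ?f = {v, w}"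
      by (auto simp: in_keys_iff lookup_minus lookup_single when_def split: if_splits)
    then have nz: "?f \<noteq> 0" by (metis insert_not_empty keys_zero)
    have "lead_word ?f \<noteq> v"
      using lead_word(2)[OF nz, of w] keys ne less trans_word_less word_less_irrefl
      by (metis insertCI transD)
    with lead_word(1)[OF nz] keys have "lead_word ?f = w" by blast
    moreover have "mset w = mset v"
      using v good(1) by (auto simp: permutations_of_set_def set_eq_iff_mset_eq_distinct)
    then have "?f \<in> fk_ideal n" by (intro rearrange_mem_fk_ideal assms(1) lists)
    ultimately show False using no_lead[OF nz] by blast
  qed
  with good show "w \<in> standard_words n" by (simp add: standard_words_def)
next
  fix w assume w: "w \<in> standard_words n"
  have "\<not> sublist (lead_word g) w" if "g \<in> G" for g
  proof
    assume "sublist (lead_word g) w"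
    then obtain a b where ab: "w = a @ lead_word g @ b" by (auto simp: sublist_def)
    let ?u = "lead_word g"
    let ?P = "permutations_of_set (set ?u)"
    have g: "g \<in> fk_ideal n" "g \<noteq> 0"
      using assms(2) that by (auto simp: groebner_basis_def)
    have "matching_letters n (set ?u)"
      using w ab by (auto simp: standard_words_def intro: matching_letters_subset)
    then have "(\<Sum>v\<in>?P. Poly_Mapping.lookup g v) = 0"
      using set_coeff_fk_ideal[OF assms(1) g(1)] by (simp add: set_coeff_def)
    moreover have u: "?u \<in> ?P" using w ab by (auto simp: standard_words_def)
    (* the coefficients of all arrangements cancel, so ?u is not the only one in g *)
    ultimately have "Poly_Mapping.lookup g ?u + (\<Sum>v\<in>?P - {?u}. Poly_Mapping.lookup g v) = 0"
      by (simp add: sum.remove[OF _ u])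
    with lead_word(1)[OF g(2)] have "(\<Sum>v\<in>?P - {?u}. Poly_Mapping.lookup g v) \<noteq> 0"
      by (auto simp: in_keys_iff)
    then have "\<not> (\<forall>v\<in>?P - {?u}. Poly_Mapping.lookup g v = 0)"
      by (metis (no_types, lifting) sum.neutral)
    then obtain v where v: "v \<in> ?P" "v \<noteq> ?u" "v \<in> Poly_Mapping.keys g"
      by (auto simp: in_keys_iff)
    then have "(v, ?u) \<in> word_less" using lead_word(2)[OF g(2)] by blast
    moreover have "length v = length ?u"
      using u v(1) by (metis length_finite_permutations_of_set)
    ultimately have "(a @ v @ b, w) \<in> word_less" unfolding ab by (rule word_less_append)
    moreover have "a @ v @ b \<in> permutations_of_set (set w)"
      using w v(1) by (auto simp: ab standard_words_def permutations_of_set_def)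
    ultimately show False using w by (auto simp: standard_words_def)
  qed
  with w standard_words_lists show "w \<in> normal_words n G"
    by (auto simp: normal_words_def)
qed

lemma bij_betw_standard_words_matchings:
  assumes "n > 1"
  shows "bij_betw (\<lambda>w. edge ` set w) (standard_words n) (matchings (cycle_edges n))"
proof -
  have matching: "edge ` S \<in> matchings (cycle_edges n) \<longleftrightarrow> matching_letters n S"
    if "S \<subseteq> cycle_vars n" for S
  proof -
    have "edge ` S \<subseteq> cycle_edges n" using that edge_image_cycle_vars by blast
    moreover have "pairwise disjnt (edge ` S) \<longleftrightarrow> pairwise (\<lambda>x y. disjnt (edge x) (edge y)) S"
      using inj_on_eq_iff[OF inj_on_subset[OF edge_inj[OF assms] that]]
      by (simp add: pairwise_image pairwise_def)
    ultimately show ?thesis using that by (simp add: matchings_def matching_letters_def)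
  qed
  show ?thesis
    unfolding bij_betw_def
  proof (intro conjI equalityI subsetI)
    show "inj_on (\<lambda>w. edge ` set w) (standard_words n)"
    proof (rule inj_onI)
      fix v w assume vw: "v \<in> standard_words n" "w \<in> standard_words n" "edge ` set v = edge ` set w"
      then have "set v = set w"
        using inj_on_image_eq_iff[OF edge_inj[OF assms]] standard_words_lists[of n]
        by (meson in_listsD subset_iff)
      with vw show "v = w" by (intro standard_words_unique)
    qed
  next
    fix M assume "M \<in> (\<lambda>w. edge ` set w) ` standard_words n"
    then show "M \<in> matchings (cycle_edges n)"
      using matching by (auto simp: standard_words_def matching_letters_def)
  next
    fix M assume M: "M \<in> matchings (cycle_edges n)"
    then have "M \<subseteq> edge ` cycle_vars n" by (simp add: matchings_def edge_image_cycle_vars)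
    then obtain S where S: "S \<subseteq> cycle_vars n" "M = edge ` S" by (auto simp: subset_image_iff)
    with M matching have "matching_letters n S" by blast
    then obtain w where "w \<in> standard_words n" "set w = S" by (rule standard_words_exists)
    with S(2) show "M \<in> (\<lambda>w. edge ` set w) ` standard_words n" by blast
  qed
qed


section \<open>The quotient algebra\<close>

lemma fk_class_eq_iff:
  assumes "n > 3"
  shows "fk_class n p = fk_class n q \<longleftrightarrow> (p - q :: var list \<Rightarrow>\<^sub>0 'f::field) \<in> fk_ideal n"
proof -
  have coset: "r \<in> fk_class n p \<longleftrightarrow> r - p \<in> fk_ideal n" for r p :: "var list \<Rightarrow>\<^sub>0 'f"
    by (force simp: fk_class_def a_r_coset_def')
  show ?thesis
  proof
    assume "fk_class n p = fk_class n q"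
    then show "p - q \<in> fk_ideal n"
      using coset[of p p] coset[of p q] fk_ideal_zero[OF assms, where 'f = 'f] by simp
  next
    assume pq: "p - q \<in> fk_ideal n"
    have "r - p \<in> fk_ideal n \<longleftrightarrow> r - q \<in> fk_ideal n" for r
      using fk_ideal_add[OF assms _ pq, of "r - p"] fk_ideal_diff[OF assms _ pq, of "r - q"] by auto
    then show "fk_class n p = fk_class n q"
      using coset by blast
  qed
qed

lemma fk_class_in_carrier:
  "p \<in> carrier (free_algebra (cycle_vars n)) \<Longrightarrow> fk_class n p \<in> carrier (fk_cycle n)"
  by (auto simp: fk_cycle_def FactRing_def A_RCOSETS_def' fk_class_def)

lemma carrier_fk_cycle:
  "carrier (fk_cycle n) = fk_class n ` carrier (free_algebra (cycle_vars n))"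
  by (auto simp: fk_cycle_def FactRing_def A_RCOSETS_def' fk_class_def)

lemma fk_class_ring_hom:
  assumes "n > 3"
  shows "fk_class n \<in> ring_hom (free_algebra (cycle_vars n) :: (var list \<Rightarrow>\<^sub>0 'f::field) ring) (fk_cycle n)"
  using ideal.rcos_ring_hom[OF ideal_fk_ideal[OF assms, where 'f = 'f]]
  by (simp add: fk_cycle_def fk_class_def[abs_def])

lemma ring_fk_cycle: "n > 3 \<Longrightarrow> ring (fk_cycle n :: (var list \<Rightarrow>\<^sub>0 'f::field) set ring)"
  unfolding fk_cycle_def by (rule ideal.quotient_is_ring[OF ideal_fk_ideal])

lemma standard_words_span:
  assumes "n > 3" "Poly_Mapping.keys (p :: var list \<Rightarrow>\<^sub>0 'f::field) \<subseteq> lists (cycle_vars n)"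
  shows "\<exists>q. Poly_Mapping.keys q \<subseteq> standard_words n \<and> p - q \<in> fk_ideal n"
  using assms(2)
proof (induction p rule: update_induct)
  case const
  show ?case using fk_ideal_zero[OF assms(1)] by (intro exI[of _ 0]) simp
next
  case (update p w c)
  let ?s = "Poly_Mapping.single [] c :: var list \<Rightarrow>\<^sub>0 'f"
  have eq: "Poly_Mapping.update w c p = p + ?s * mon w"
    using update.hyps by (simp add: update_eq_plus_single mult_single plus_list_def)
  from update have lists: "w \<in> lists (cycle_vars n)" "Poly_Mapping.keys p \<subseteq> lists (cycle_vars n)"
    by (auto simp: keys_update)
  from update.IH[OF lists(2)] obtain q where
    q: "Poly_Mapping.keys q \<subseteq> standard_words n" "p - q \<in> fk_ideal n" by blast
  have "\<exists>r :: var list \<Rightarrow>\<^sub>0 'f. Poly_Mapping.keys r \<subseteq> standard_words n \<and> mon w - r \<in> fk_ideal n"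
  proof (cases "distinct w \<and> matching_letters n (set w)")
    case True
    then obtain v where v: "v \<in> standard_words n" "set v = set w"
      by (auto elim: standard_words_exists)
    with True have "mset w = mset v"
      by (auto simp: standard_words_def set_eq_iff_mset_eq_distinct)
    with v(1) show ?thesis
      using rearrange_mem_fk_ideal[OF assms(1) _ lists(1), of v, where 'f = 'f]
      by (intro exI[of _ "mon v"]) simp
  next
    case False
    then show ?thesis
      using mon_mem_fk_ideal[OF assms(1) lists(1), where 'f = 'f] by (intro exI[of _ 0]) simp
  qed
  then obtain r :: "var list \<Rightarrow>\<^sub>0 'f" where
    r: "Poly_Mapping.keys r \<subseteq> standard_words n" "mon w - r \<in> fk_ideal n" by blast
  have "Poly_Mapping.keys (?s * r) \<subseteq> standard_words n"
    using keys_mult[of ?s r] r(1) by (auto simp: plus_list_def split: if_splits)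
  then have keys: "Poly_Mapping.keys (q + ?s * r) \<subseteq> standard_words n"
    using q(1) Poly_Mapping.keys_add[of q "?s * r"] by blast
  have "?s * (mon w - r) \<in> fk_ideal n"
    using r(2) by (intro fk_ideal_mult_left assms(1)) (auto simp: mem_carrier_free_algebra)
  with q(2) have "(p - q) + ?s * (mon w - r) \<in> fk_ideal n"
    by (rule fk_ideal_add[OF assms(1)])
  moreover have "(p - q) + ?s * (mon w - r) = Poly_Mapping.update w c p - (q + ?s * r)"
    by (simp add: eq right_diff_distrib)
  ultimately show ?case using keys by metis
qed

text \<open>The functional \<open>set_coeff (set w)\<close> separates \<open>w\<close> from the other standard words, since no
  other standard word has the same letters.\<close>

lemma standard_words_independent:
  assumes "n > 3" "w \<in> standard_words n" "Poly_Mapping.keys q \<subseteq> standard_words n - {w}"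
  shows "fk_class n (mon w) \<noteq> fk_class n (q :: var list \<Rightarrow>\<^sub>0 'f::field)"
proof
  assume "fk_class n (mon w) = fk_class n q"
  then have "set_coeff (set w) (mon w - q) = 0"
    using assms(2) by (intro set_coeff_fk_ideal[OF assms(1)])
      (auto simp: fk_class_eq_iff[OF assms(1)] standard_words_def)
  moreover have "set_coeff (set w) q = 0"
    unfolding set_coeff_def
  proof (rule sum.neutral, rule ballI)
    fix v assume "v \<in> permutations_of_set (set w)"
    then have "v \<notin> Poly_Mapping.keys q"
      using assms(2,3) standard_words_unique[of v n w] by (auto simp: permutations_of_set_def)
    then show "Poly_Mapping.lookup q v = 0" by (simp add: in_keys_iff)
  qed
  moreover have "w \<in> permutations_of_set (set w)"
    using assms(2) by (auto simp: standard_words_def)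
  ultimately show False by (simp add: set_coeff_diff set_coeff_single)
qed

text \<open>The words are adjoined one at a time: the span of \<open>w # ws\<close> is the line extension of the span
  of \<open>ws\<close> by the class of \<open>w\<close>, which is proper by \<open>standard_words_independent\<close>.\<close>

lemma dimension_standard_words:
  assumes "n > 3" "distinct ws" "set ws \<subseteq> standard_words n"
  shows "ring.dimension (fk_cycle n :: (var list \<Rightarrow>\<^sub>0 'f::field) set ring) (length ws) (fk_scalars n)
    (fk_class n ` {p. Poly_Mapping.keys p \<subseteq> set ws})"
proof -
  interpret A: ring "fk_cycle n :: (var list \<Rightarrow>\<^sub>0 'f) set ring"
    by (rule ring_fk_cycle[OF assms(1)])
  show ?thesis
    using assms(2,3)
  proof (induction ws)
    case Nil
    have "fk_class n ` {p :: var list \<Rightarrow>\<^sub>0 'f. Poly_Mapping.keys p \<subseteq> set []} = {fk_class n 0}"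
      by auto
    also have "fk_class n (0 :: var list \<Rightarrow>\<^sub>0 'f) = \<zero>\<^bsub>fk_cycle n\<^esub>"
      using ring_hom_zero[OF fk_class_ring_hom[OF assms(1)] ring_free_algebra A.ring_axioms] by simp
    finally show ?case using A.zero_dim by simp
  next
    case (Cons w ws)
    let ?E = "fk_class n ` {p :: var list \<Rightarrow>\<^sub>0 'f. Poly_Mapping.keys p \<subseteq> set ws}"
    have w: "w \<in> standard_words n" "w \<in> lists (cycle_vars n)"
      using Cons.prems standard_words_lists by auto
    have comb: "fk_class n (Poly_Mapping.single [] c) \<otimes>\<^bsub>fk_cycle n\<^esub> fk_class n (mon w)
        \<oplus>\<^bsub>fk_cycle n\<^esub> fk_class n q = fk_class n (Poly_Mapping.single w c + q)"
      if "Poly_Mapping.keys q \<subseteq> set ws" for c and q :: "var list \<Rightarrow>\<^sub>0 'f"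
    proof -
      have mem: "Poly_Mapping.single [] c \<in> carrier (free_algebra (cycle_vars n))"
        "Poly_Mapping.single w c \<in> carrier (free_algebra (cycle_vars n))"
        "(mon w :: var list \<Rightarrow>\<^sub>0 'f) \<in> carrier (free_algebra (cycle_vars n))"
        "q \<in> carrier (free_algebra (cycle_vars n))"
        using w(2) that Cons.prems standard_words_lists[of n]
        by (auto simp: mem_carrier_free_algebra subset_iff)
      show ?thesis
        using ring_hom_mult[OF fk_class_ring_hom[OF assms(1)] mem(1,3)]
          ring_hom_add[OF fk_class_ring_hom[OF assms(1)] mem(2,4)]
        by (simp add: mult_single plus_list_def)
    qed
    have "fk_class n ` {p :: var list \<Rightarrow>\<^sub>0 'f. Poly_Mapping.keys p \<subseteq> set (w # ws)} =
        A.line_extension (fk_scalars n) (fk_class n (mon w)) ?E"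
    proof (intro equalityI subsetI)
      fix u assume "u \<in> fk_class n ` {p :: var list \<Rightarrow>\<^sub>0 'f. Poly_Mapping.keys p \<subseteq> set (w # ws)}"
      then obtain p :: "var list \<Rightarrow>\<^sub>0 'f" where
        p: "u = fk_class n p" "Poly_Mapping.keys p \<subseteq> set (w # ws)" by blast
      let ?c = "Poly_Mapping.lookup p w"
      let ?q = "p - Poly_Mapping.single w ?c"
      have "Poly_Mapping.keys ?q \<subseteq> set ws"
        using p(2) by (auto simp: in_keys_iff lookup_minus lookup_single when_def split: if_splits)
      then show "u \<in> A.line_extension (fk_scalars n) (fk_class n (mon w)) ?E"
        using comb[of ?q ?c] unfolding A.line_extension_mem_iff fk_scalars_def p(1) by force
    next
      fix u assume "u \<in> A.line_extension (fk_scalars n) (fk_class n (mon w)) ?E"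
      then obtain c q where q: "Poly_Mapping.keys q \<subseteq> set ws"
          "u = fk_class n (Poly_Mapping.single w c + q)"
        unfolding A.line_extension_mem_iff fk_scalars_def using comb by force
      moreover have "Poly_Mapping.keys (Poly_Mapping.single w c + q) \<subseteq> set (w # ws)"
        using q(1) Poly_Mapping.keys_add[of "Poly_Mapping.single w c" q] by (auto split: if_splits)
      ultimately show "u \<in> fk_class n ` {p :: var list \<Rightarrow>\<^sub>0 'f. Poly_Mapping.keys p \<subseteq> set (w # ws)}"
        by blast
    qed
    moreover have "fk_class n (mon w) \<notin> ?E"
      using standard_words_independent[OF assms(1) w(1), where 'f = 'f] Cons.prems by fastforce
    moreover have "fk_class n (mon w :: var list \<Rightarrow>\<^sub>0 'f) \<in> carrier (fk_cycle n)"
      using w(2) by (intro fk_class_in_carrier) (simp add: mon_mem_carrier)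
    ultimately show ?case
      using A.Suc_dim[of "fk_class n (mon w)" ?E "length ws" "fk_scalars n"] Cons by simp
  qed
qed

lemma carrier_fk_cycle_standard:
  assumes "n > 3"
  shows "(carrier (fk_cycle n) :: (var list \<Rightarrow>\<^sub>0 'f::field) set set) =
    fk_class n ` {p. Poly_Mapping.keys p \<subseteq> standard_words n}"
proof (intro equalityI subsetI)
  fix u assume "u \<in> (carrier (fk_cycle n) :: (var list \<Rightarrow>\<^sub>0 'f) set set)"
  then obtain p :: "var list \<Rightarrow>\<^sub>0 'f" where
    p: "u = fk_class n p" "Poly_Mapping.keys p \<subseteq> lists (cycle_vars n)"
    by (auto simp: carrier_fk_cycle mem_carrier_free_algebra)
  with standard_words_span[OF assms p(2)]
  show "u \<in> fk_class n ` {p. Poly_Mapping.keys p \<subseteq> standard_words n}"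
    by (auto simp: fk_class_eq_iff[OF assms] image_iff)
next
  fix u assume "u \<in> fk_class n ` {p :: var list \<Rightarrow>\<^sub>0 'f. Poly_Mapping.keys p \<subseteq> standard_words n}"
  then show "u \<in> carrier (fk_cycle n)"
    using standard_words_lists[of n]
    by (auto simp only: carrier_fk_cycle mem_carrier_free_algebra)
qed

lemma inj_on_fk_class_standard_words:
  assumes "n > 3"
  shows "inj_on (\<lambda>w. fk_class n (mon w :: var list \<Rightarrow>\<^sub>0 'f::field)) (standard_words n)"
  using standard_words_independent[OF assms, where 'f = 'f]
  by (intro inj_onI) (metis (no_types, lifting) Diff_iff empty_subsetI insert_subset keys_single
      singletonD zero_neq_one)

theorem theorem2p10:
  fixes n :: nat
  assumes "n > 3"
  shows "(\<forall>G :: (var list \<Rightarrow>\<^sub>0 'f::field) set. groebner_basis (fk_ideal n) G \<longrightarrow>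
           (\<exists>\<phi>. bij_betw \<phi> (fk_basis n G) (matchings (cycle_edges n))))
       \<and> ring.dimension (fk_cycle n :: (var list \<Rightarrow>\<^sub>0 'f) set ring)
           (card (matchings (cycle_edges n))) (fk_scalars n) (carrier (fk_cycle n))"
proof (intro conjI allI impI)
  have n1: "n > 1" using assms by simp
  fix G :: "(var list \<Rightarrow>\<^sub>0 'f) set" assume G: "groebner_basis (fk_ideal n) G"
  have "bij_betw (\<lambda>w. fk_class n (mon w :: var list \<Rightarrow>\<^sub>0 'f)) (standard_words n) (fk_basis n G)"
    unfolding fk_basis_def normal_words_eq_standard_words[OF assms G]
    by (rule inj_on_imp_bij_betw[OF inj_on_fk_class_standard_words[OF assms]])
  then show "\<exists>\<phi>. bij_betw \<phi> (fk_basis n G) (matchings (cycle_edges n))"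
    using bij_betw_standard_words_matchings[OF n1] bij_betw_inv_into bij_betw_trans by blast
next
  have n1: "n > 1" using assms by simp
  have "finite (matchings (cycle_edges n))"
    using finite_imageI[OF finite_cycle_vars[of n], of edge]
    by (auto simp: matchings_def edge_image_cycle_vars)
  then have "finite (standard_words n)"
    using bij_betw_finite[OF bij_betw_standard_words_matchings[OF n1]] by blast
  then obtain ws where ws: "set ws = standard_words n" "distinct ws"
    using finite_distinct_list by blast
  then have "length ws = card (matchings (cycle_edges n))"
    using bij_betw_same_card[OF bij_betw_standard_words_matchings[OF n1]] by (metis distinct_card)
  with ws dimension_standard_words[OF assms ws(2), where 'f = 'f]
  show "ring.dimension (fk_cycle n :: (var list \<Rightarrow>\<^sub>0 'f) set ring)
      (card (matchings (cycle_edges n))) (fk_scalars n) (carrier (fk_cycle n))"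
    by (simp add: carrier_fk_cycle_standard[OF assms])
qed

end
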